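(* Let $\ell\geq 1$ be an integer. Then, for all integers $n\geq \ell+2$, $$\begin{aligned}(n-2)^{\ell} ={}&\left(\frac{n}{n-1}\right)^{n-\ell-2} \sum_{k=0}^{\ell-1}(n-1)^{\ell-k-1}(n-2)^{k-1}(n-k-2) \\ &+ \frac{(n-2)^{\ell-1}}{n-\ell-1} \sum_{k=\ell}^{n-2}\left(\frac{n}{n-1}\right)^{n-k-2}\left((n-k-\ell-2) + \frac{(\ell+1)\,nk + \ell\,(n-k-2)}{n\,(n-1)}\right).\end{aligned}$$
   Context: The identity is between rational numbers (negative exponents such as $(n-2)^{-1}$ are interpreted in $\mathbb{Q}$). *)

theory Defs
  imports Complex_Main
begin

end

theory Submission
  imports Defs
begin

text \<open>
  Both sums telescope. Write \<open>r = n / (n - 1)\<close>. The summand of the first sum is the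
  increment of \<open>k (n-1)^(l-k) (n-2)^(k-1)\<close>, so that sum equals \<open>l (n-2)^(l-1)\<close>
  (lemma \<open>first_sum_closed_form\<close>). The summand of the second one is the increment of
  \<open>r^(n-k-1) c k\<close>, where \<open>c k = (n-l-2) k + l (k+1) / n\<close>. Since
  \<open>c (n-1) = (n-l-1) (n-2)\<close> and \<open>r c l = l (n-l-1)\<close>, that sum equals
  \<open>(n-l-1) ((n-2) - l r^(n-l-2))\<close> (lemma \<open>second_sum_closed_form\<close>).
  On substituting these values, the term \<open>l r^(n-l-2) (n-2)^(l-1)\<close> coming from the first
  sum cancels against its negative from the second, and \<open>(n-2)^l\<close> is left.

  The two primitives were determined by an ansatz: a geometric factor times a polynomial in \<open>k\<close>
  of degree one, whose coefficients follow by comparison with the summand.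
\<close>

lemma sum_telescope_int:
  fixes f :: "int \<Rightarrow> 'a::ab_group_add"
  assumes "a \<le> b"
  shows "(\<Sum>k = a..b - 1. f (k + 1) - f k) = f b - f a"
  using assms
proof (induction b rule: int_ge_induct)
  case base
  then show ?case by simp
next
  case (step b)
  have "{a..b + 1 - 1} = insert b {a..b - 1}"
    using step.hyps by auto
  then show ?case
    using step.IH by simp
qed

text \<open>
  The increment of \<open>k x^(l-k) y^(k-1)\<close> is \<open>x^(l-k-1) y^(k-1) ((k+1) y - k x)\<close>;
  since \<open>x = y + 1\<close>, the last factor is \<open>y - k\<close>.
\<close>

lemma first_sum_closed_form:
  fixes x y :: "'a::field" and l :: int
  assumes "x = y + 1" and "x \<noteq> 0" and "y \<noteq> 0" and "l \<ge> 0"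
  shows "(\<Sum>k = 0..l - 1. x powi (l - k - 1) * y powi (k - 1) * (y - of_int k))
    = of_int l * y powi (l - 1)"
proof -
  define F where "F k = of_int k * x powi (l - k) * y powi (k - 1)" for k :: int
  have "x powi (l - k - 1) * y powi (k - 1) * (y - of_int k) = F (k + 1) - F k" for k
  proof -
    have "x powi (l - k) = x * x powi (l - k - 1)"
      using \<open>x \<noteq> 0\<close> power_int_add_1'[of x "l - k - 1"] by simp
    moreover have "y powi k = y * y powi (k - 1)"
      using \<open>y \<noteq> 0\<close> power_int_add_1'[of y "k - 1"] by simp
    moreover have "l - (k + 1) = l - k - 1" by simp
    ultimately show ?thesis
      unfolding F_def using \<open>x = y + 1\<close> by (simp add: algebra_simps)
  qed
  then show ?thesis
    using sum_telescope_int[of 0 l F] \<open>l \<ge> 0\<close> by (simp add: F_def)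
qed

text \<open>
  The increment of \<open>r^(m-k-1) c k\<close> is \<open>r^(m-k-2) (c (k+1) - r c k)\<close>, and requiring the
  factor \<open>c (k+1) - r c k\<close> to be the bracket in the summand forces
  \<open>c k = (m-l-2) k + l (k+1) / m\<close>.
\<close>

lemma second_sum_closed_form:
  fixes m l :: int and r :: "'a::field_char_0"
  assumes "m \<noteq> 0" and "m \<noteq> 1" and "l \<le> m - 1"
  defines "r \<equiv> of_int m / of_int (m - 1)"
  shows "(\<Sum>k = l..m - 2. r powi (m - k - 2)
             * (of_int (m - k - l - 2)
                + of_int ((l + 1) * m * k + l * (m - k - 2)) / of_int (m * (m - 1))))
    = of_int (m - l - 1) * (of_int (m - 2) - of_int l * r powi (m - l - 2))"
proof -
  define c :: "int \<Rightarrow> 'a"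
    where "c k = of_int ((m - l - 2) * k) + of_int (l * (k + 1)) / of_int m" for k
  define G where "G k = r powi (m - k - 1) * c k" for k
  have m0: "(of_int m :: 'a) \<noteq> 0" using \<open>m \<noteq> 0\<close> by simp
  have m1: "(of_int m - 1 :: 'a) \<noteq> 0"
    using \<open>m \<noteq> 1\<close> by (metis of_int_1 of_int_eq_iff right_minus_eq)
  have "r \<noteq> 0" using m0 m1 by (simp add: r_def)
  then have pow: "r powi (m - k - 1) = r * r powi (m - k - 2)" for k
    using power_int_add_1'[of r "m - k - 2"] by simp
  have bracket: "of_int (m - k - l - 2)
      + of_int ((l + 1) * m * k + l * (m - k - 2)) / of_int (m * (m - 1)) = c (k + 1) - r * c k" for k
    unfolding c_def r_def using m0 m1 by (simp add: divide_simps) (simp add: algebra_simps)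
  have "r powi (m - k - 2) * (of_int (m - k - l - 2)
      + of_int ((l + 1) * m * k + l * (m - k - 2)) / of_int (m * (m - 1))) = G (k + 1) - G k" for k
  proof -
    have "m - (k + 1) - 1 = m - k - 2" by simp
    then have "G (k + 1) = r powi (m - k - 2) * c (k + 1)"
      unfolding G_def by (simp only:)
    moreover have "G k = r powi (m - k - 2) * (r * c k)"
      unfolding G_def pow by (simp only: mult_ac)
    ultimately show ?thesis
      unfolding bracket by (simp only: right_diff_distrib)
  qed
  then have "(\<Sum>k = l..m - 2. r powi (m - k - 2)
             * (of_int (m - k - l - 2)
                + of_int ((l + 1) * m * k + l * (m - k - 2)) / of_int (m * (m - 1))))
    = G (m - 1) - G l"
    using sum_telescope_int[of l "m - 1" G] \<open>l \<le> m - 1\<close> by simp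
  also have "G (m - 1) = of_int (m - l - 1) * of_int (m - 2)"
    unfolding G_def c_def using m0 by (simp add: algebra_simps)
  also have "G l = of_int (m - l - 1) * (of_int l * r powi (m - l - 2))"
  proof -
    have "r * c l = of_int l * of_int (m - l - 1)"
      unfolding c_def r_def using m0 m1 by (simp add: divide_simps) (simp add: algebra_simps)
    then show ?thesis
      unfolding G_def pow by (simp add: mult_ac)
  qed
  finally show ?thesis by (simp only: right_diff_distrib)
qed

theorem proposition3p2:
  fixes l n :: int
  assumes "l \<ge> 1" and "n \<ge> l + 2"
  shows "(of_int (n - 2) :: rat) powi l =
      (of_int n / of_int (n - 1)) powi (n - l - 2)
        * (\<Sum>k = 0..l - 1. of_int (n - 1) powi (l - k - 1) * of_int (n - 2) powi (k - 1)
             * of_int (n - k - 2))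
      + of_int (n - 2) powi (l - 1) / of_int (n - l - 1)
        * (\<Sum>k = l..n - 2. (of_int n / of_int (n - 1)) powi (n - k - 2)
             * (of_int (n - k - l - 2)
                + of_int ((l + 1) * n * k + l * (n - k - 2)) / of_int (n * (n - 1))))"
proof -
  let ?r = "of_int n / of_int (n - 1) :: rat"
  let ?y = "of_int (n - 2) :: rat"
  have y: "?y \<noteq> 0" and d: "(of_int (n - l - 1) :: rat) \<noteq> 0" and x: "(of_int (n - 1) :: rat) \<noteq> 0"
    using assms by (simp_all only: of_int_eq_0_iff)
  have first: "(\<Sum>k = 0..l - 1. of_int (n - 1) powi (l - k - 1) * ?y powi (k - 1) * of_int (n - k - 2))
      = of_int l * ?y powi (l - 1)"
    using first_sum_closed_form[of "of_int (n - 1)" ?y l] x y \<open>l \<ge> 1\<close>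
    by (simp add: algebra_simps)
  have second: "(\<Sum>k = l..n - 2. ?r powi (n - k - 2)
             * (of_int (n - k - l - 2)
                + of_int ((l + 1) * n * k + l * (n - k - 2)) / of_int (n * (n - 1))))
      = of_int (n - l - 1) * (?y - of_int l * ?r powi (n - l - 2))"
    using assms by (intro second_sum_closed_form) simp_all
  have "?y powi l = ?y * ?y powi (l - 1)"
    using y power_int_add_1'[of ?y "l - 1"] by simp
  then show ?thesis
    unfolding first second using d by (simp add: field_simps del: of_int_diff)
qed

end
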